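(* Let $(M^n,g)$ be a smooth pseudo-Riemannian manifold with a continuously differentiable $(0,2)$-tensor field $F=F_{ij}$. Then $F(v,v)\ge 0$ for all null vectors $v\in TM$ if and only if for each compact subset $Z\subset M$ $$C_Z^T := \inf_{z\in Z}\ \inf_{p\in T_zM,\ g_z(p,p)>0}\ \frac{F_z(p,p)}{g_z(p,p)}\ >\ -\infty .$$
   Context: The metric $g$ is a smooth nondegenerate symmetric $(0,2)$-tensor field of arbitrary signature. A vector $v\in T_zM$ is null if $g_z(v,v)=0$. The infimum of the empty set is $+\infty$. *)

theory Defs
  imports "HOL-Analysis.Analysis"
begin

section \<open>Functions of class \<open>C\<^sup>k\<close> on open subsets of Euclidean spaces\<close>

text \<open>Only used on open sets \<open>S\<close>.  In finite dimension, continuity of every directional map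
  \<open>x \<mapsto> Df(x) v\<close> is continuity of \<open>Df\<close>, so this is the usual notion.\<close>

primrec Ck_on ::
  "nat \<Rightarrow> 'a::euclidean_space set \<Rightarrow> ('a \<Rightarrow> 'b::real_normed_vector) \<Rightarrow> bool" where
  "Ck_on 0 S f \<longleftrightarrow> continuous_on S f"
| "Ck_on (Suc k) S f \<longleftrightarrow> (\<forall>x\<in>S. f differentiable (at x)) \<and>
     (\<forall>v. Ck_on k S (\<lambda>x. frechet_derivative f (at x) v))"

definition smooth_on :: "'a::euclidean_space set \<Rightarrow> ('a \<Rightarrow> 'b::real_normed_vector) \<Rightarrow> bool" where
  "smooth_on S f \<longleftrightarrow> (\<forall>k. Ck_on k S f)"


section \<open>Smooth manifolds\<close>

text \<open>A chart is a pair of its domain and its coordinate map; the values of the coordinate map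
  outside the domain are irrelevant.  The model space is \<open>'e\<close>, so the dimension of the manifold
  is \<open>DIM('e)\<close>.\<close>

type_synonym ('m, 'e) chart = "'m set \<times> ('m \<Rightarrow> 'e)"

abbreviation chart_dom :: "('m, 'e) chart \<Rightarrow> 'm set" where
  "chart_dom c \<equiv> fst c"

abbreviation chart_map :: "('m, 'e) chart \<Rightarrow> 'm \<Rightarrow> 'e" where
  "chart_map c \<equiv> snd c"

definition chart_inv :: "('m, 'e) chart \<Rightarrow> 'e \<Rightarrow> 'm" where
  "chart_inv c = inv_into (chart_dom c) (chart_map c)"

definition is_chart :: "'m topology \<Rightarrow> ('m, 'e::euclidean_space) chart \<Rightarrow> bool" where
  "is_chart X c \<longleftrightarrow> openin X (chart_dom c) \<and> open (chart_map c ` chart_dom c) \<and>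
     homeomorphic_map (subtopology X (chart_dom c))
       (top_of_set (chart_map c ` chart_dom c)) (chart_map c)"

definition transition :: "('m, 'e) chart \<Rightarrow> ('m, 'e) chart \<Rightarrow> 'e \<Rightarrow> 'e" where
  "transition c d = chart_map d \<circ> chart_inv c"

definition smooth_manifold :: "'m topology \<Rightarrow> ('m, 'e::euclidean_space) chart set \<Rightarrow> bool" where
  "smooth_manifold X A \<longleftrightarrow>
     Hausdorff_space X \<and> second_countable X \<and>
     (\<forall>c\<in>A. is_chart X c) \<and> (\<Union>c\<in>A. chart_dom c) = topspace X \<and>
     (\<forall>c\<in>A. \<forall>d\<in>A. smooth_on (chart_map c ` (chart_dom c \<inter> chart_dom d)) (transition c d))"


section \<open>Tangent vectors\<close>

text \<open>A tangent vector at \<open>z\<close> is an equivalence class of pairs \<open>(c, v)\<close> of a chart around \<open>z\<close> and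
  a vector of the model space, where \<open>(c, v) \<sim> (d, w)\<close> iff \<open>w\<close> is the image of \<open>v\<close> under the
  derivative of the change of coordinates.  Such a class contains exactly one pair for each
  chart around \<open>z\<close>, so it is encoded as the function sending a chart to the components of the
  vector in that chart; it is set to \<open>0\<close> on everything that is not a chart around \<open>z\<close>, which makes
  the encoding unique.  The vector space operations are then pointwise.\<close>

type_synonym ('m, 'e) tvec = "('m, 'e) chart \<Rightarrow> 'e"

definition charts_at :: "('m, 'e) chart set \<Rightarrow> 'm \<Rightarrow> ('m, 'e) chart set" where
  "charts_at A z = {c \<in> A. z \<in> chart_dom c}"

definition tangent_space ::
  "('m, 'e::euclidean_space) chart set \<Rightarrow> 'm \<Rightarrow> ('m, 'e) tvec set" where
  "tangent_space A z = {v.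
     (\<forall>c\<in>charts_at A z. \<forall>d\<in>charts_at A z.
        v d = frechet_derivative (transition c d) (at (chart_map c z)) (v c)) \<and>
     (\<forall>c. c \<notin> charts_at A z \<longrightarrow> v c = 0)}"

text \<open>The tangent vector at \<open>z\<close> whose components in the chart \<open>c\<close> are \<open>e\<close>.  For \<open>e\<close> in the standard
  basis these are the coordinate vectors of \<open>c\<close>.\<close>

definition coord_vec ::
  "('m, 'e::euclidean_space) chart set \<Rightarrow> ('m, 'e) chart \<Rightarrow> 'm \<Rightarrow> 'e \<Rightarrow> ('m, 'e) tvec" where
  "coord_vec A c z e = (\<lambda>d. if d \<in> charts_at A z
     then frechet_derivative (transition c d) (at (chart_map c z)) e else 0)"


section \<open>Tensor fields of type \<open>(0,2)\<close> and pseudo-Riemannian metrics\<close>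

text \<open>Only the values of a tensor field on points of the manifold and on tangent vectors at these
  points are meaningful.\<close>

type_synonym ('m, 'e) tensor02 = "'m \<Rightarrow> ('m, 'e) tvec \<Rightarrow> ('m, 'e) tvec \<Rightarrow> real"

definition tensor02_field ::
  "'m topology \<Rightarrow> ('m, 'e::euclidean_space) chart set \<Rightarrow> ('m, 'e) tensor02 \<Rightarrow> bool" where
  "tensor02_field X A F \<longleftrightarrow>
     (\<forall>z\<in>topspace X. \<forall>u\<in>tangent_space A z. \<forall>v\<in>tangent_space A z. \<forall>w\<in>tangent_space A z.
        \<forall>a b. F z (\<lambda>c. a *\<^sub>R u c + b *\<^sub>R v c) w = a * F z u w + b * F z v w \<and>
              F z w (\<lambda>c. a *\<^sub>R u c + b *\<^sub>R v c) = a * F z w u + b * F z w v)"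

definition tensor02_component ::
  "('m, 'e::euclidean_space) chart set \<Rightarrow> ('m, 'e) tensor02 \<Rightarrow> ('m, 'e) chart
     \<Rightarrow> 'e \<Rightarrow> 'e \<Rightarrow> 'e \<Rightarrow> real" where
  "tensor02_component A F c i j x =
     F (chart_inv c x) (coord_vec A c (chart_inv c x) i) (coord_vec A c (chart_inv c x) j)"

definition Ck_tensor02_field ::
  "nat \<Rightarrow> 'm topology \<Rightarrow> ('m, 'e::euclidean_space) chart set \<Rightarrow> ('m, 'e) tensor02 \<Rightarrow> bool" where
  "Ck_tensor02_field k X A F \<longleftrightarrow> tensor02_field X A F \<and>
     (\<forall>c\<in>A. \<forall>i\<in>Basis. \<forall>j\<in>Basis.
        Ck_on k (chart_map c ` chart_dom c) (tensor02_component A F c i j))"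

definition smooth_tensor02_field ::
  "'m topology \<Rightarrow> ('m, 'e::euclidean_space) chart set \<Rightarrow> ('m, 'e) tensor02 \<Rightarrow> bool" where
  "smooth_tensor02_field X A F \<longleftrightarrow> tensor02_field X A F \<and>
     (\<forall>c\<in>A. \<forall>i\<in>Basis. \<forall>j\<in>Basis.
        smooth_on (chart_map c ` chart_dom c) (tensor02_component A F c i j))"

definition pseudo_riemannian_metric ::
  "'m topology \<Rightarrow> ('m, 'e::euclidean_space) chart set \<Rightarrow> ('m, 'e) tensor02 \<Rightarrow> bool" where
  "pseudo_riemannian_metric X A g \<longleftrightarrow> smooth_tensor02_field X A g \<and>
     (\<forall>z\<in>topspace X. \<forall>u\<in>tangent_space A z. \<forall>v\<in>tangent_space A z. g z u v = g z v u) \<and>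
     (\<forall>z\<in>topspace X. \<forall>u\<in>tangent_space A z.
        (\<forall>v\<in>tangent_space A z. g z u v = 0) \<longrightarrow> u = (\<lambda>c. 0))"

definition null_vectors ::
  "('m, 'e::euclidean_space) chart set \<Rightarrow> ('m, 'e) tensor02 \<Rightarrow> 'm \<Rightarrow> ('m, 'e) tvec set" where
  "null_vectors A g z = {v \<in> tangent_space A z. g z v v = 0}"

text \<open>Infima are taken in the extended reals, so the infimum of the empty set is \<open>\<infinity>\<close>.\<close>

definition C_T ::
  "('m, 'e::euclidean_space) chart set \<Rightarrow> ('m, 'e) tensor02 \<Rightarrow> ('m, 'e) tensor02
     \<Rightarrow> 'm set \<Rightarrow> ereal" where
  "C_T A g F Z =
     (INF z\<in>Z. INF p\<in>{p \<in> tangent_space A z. g z p p > 0}. ereal (F z p p / g z p p))"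

end

theory Submission
  imports Defs
begin

text \<open>If \<open>v \<noteq> 0\<close> is null, nondegeneracy gives \<open>w\<close> with \<open>g(v,w) \<noteq> 0\<close>, so \<open>v\<close> is a limit of vectors
  \<open>v + t w\<close> with \<open>g > 0\<close>; a lower bound \<open>F \<ge> B g\<close> on these passes to the limit \<open>F(v,v) \<ge> 0\<close>.

  Conversely, let \<open>F \<ge> 0\<close> on null vectors.  If \<open>g(p,p) > 0 > g(q,q)\<close>, the two null lines in the
  plane spanned by \<open>p\<close> and \<open>q\<close> give \<open>F(p,p) / g(p,p) \<ge> F(q,q) / g(q,q)\<close>.  Hence near a point where
  \<open>g\<close> takes a negative value, a single vector \<open>q\<close> with constant components provides a locally
  uniform lower bound.  Near any other point \<open>g\<close> is positive definite, and compactness of the unit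
  sphere gives the bound.  Finitely many such neighbourhoods cover a compact set.\<close>

section \<open>Pairs of bilinear forms\<close>

text \<open>The two mixed terms are kept apart because \<open>F\<close> is a general (0,2)-tensor;
  only the metric is symmetric.\<close>

lemma bilinear_expand_add_scale:
  fixes f :: "'a::real_vector \<Rightarrow> 'a \<Rightarrow> real"
  assumes "bilinear f"
  shows "f (p + t *\<^sub>R q) (p + t *\<^sub>R q) = f p p + t * (f p q + f q p) + t\<^sup>2 * f q q"
  by (simp add: bilinear_ladd[OF assms] bilinear_radd[OF assms] bilinear_lmul[OF assms]
      bilinear_rmul[OF assms] algebra_simps power2_eq_square)

lemma bilinear_scale_both:
  fixes f :: "'a::real_vector \<Rightarrow> 'a \<Rightarrow> real"
  assumes "bilinear f"
  shows "f (t *\<^sub>R q) (t *\<^sub>R q) = t\<^sup>2 * f q q"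
  by (simp add: bilinear_lmul[OF assms] bilinear_rmul[OF assms] power2_eq_square)

text \<open>Since \<open>a * c < 0\<close>, the discriminant exceeds the square of \<open>b\<close>,
  so its root \<open>D\<close> dominates \<open>\<bar>b\<bar>\<close> and the numerators
  \<open>- b + D\<close> and \<open>- b - D\<close> have opposite signs. Below, the polynomial is
  the restriction of \<open>g\<close> to a line \<open>p + t q\<close>.\<close>

lemma quadratic_roots_opposite_sign:
  fixes a b c :: real
  assumes "a > 0" "c < 0"
  obtains s t where "s < 0" "0 < t" "s * t = a / c"
    "a + s * b + s\<^sup>2 * c = 0" "a + t * b + t\<^sup>2 * c = 0"
proof -
  define D where "D = sqrt (b\<^sup>2 - 4 * (a * c))"
  have ac: "a * c < 0" using assms by (simp add: mult_pos_neg)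
  have D2: "D\<^sup>2 = b\<^sup>2 - 4 * (a * c)"
    unfolding D_def using ac zero_le_power2[of b] by (intro real_sqrt_pow2) linarith
  have "\<bar>b\<bar> < D"
    unfolding D_def using ac by (intro real_less_rsqrt) simp
  then have D: "D > b" "D > - b" by auto
  define s where "s = (- b + D) / (2 * c)"
  define t where "t = (- b - D) / (2 * c)"
  have "s < 0" "t > 0" using D assms(2) by (simp_all add: s_def t_def divide_less_0_iff zero_less_divide_iff)
  moreover have "s * t = (b\<^sup>2 - D\<^sup>2) / (4 * c\<^sup>2)"
    by (simp add: s_def t_def field_simps power2_eq_square)
  then have "s * t = a / c"
    unfolding D2 using assms(2) by (simp add: power2_eq_square)
  moreover have "a + s * b + s\<^sup>2 * c = (4 * a * c - b\<^sup>2 + D\<^sup>2) / (4 * c)"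
    "a + t * b + t\<^sup>2 * c = (4 * a * c - b\<^sup>2 + D\<^sup>2) / (4 * c)"
    using assms(2) by (simp_all add: s_def t_def field_simps power2_eq_square)
  ultimately show thesis by (intro that[of s t]) (simp_all add: D2)
qed

text \<open>The vectors \<open>p + s q\<close> and \<open>p + t q\<close> are null for
  \<open>g\<close>, so \<open>f\<close> is nonnegative on both. A combination with positive weights
  eliminates the mixed terms, and the product \<open>s * t = g p p / g q q\<close> of the roots
  turns what remains into a comparison of the two ratios.\<close>

lemma bilinear_ratio_le:
  fixes f g :: "'a::real_vector \<Rightarrow> 'a \<Rightarrow> real"
  assumes f: "bilinear f" and g: "bilinear g"
    and null: "\<And>u. g u u = 0 \<Longrightarrow> f u u \<ge> 0"
    and p: "g p p > 0" and q: "g q q < 0"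
  shows "f q q / g q q \<le> f p p / g p p"
proof -
  obtain s t where st: "s < 0" "0 < t" "s * t = g p p / g q q"
    and roots: "g p p + s * (g p q + g q p) + s\<^sup>2 * g q q = 0"
      "g p p + t * (g p q + g q p) + t\<^sup>2 * g q q = 0"
    using quadratic_roots_opposite_sign[OF p q] by metis
  define b where "b = f p q + f q p"
  have "f p p + s * b + s\<^sup>2 * f q q \<ge> 0" "f p p + t * b + t\<^sup>2 * f q q \<ge> 0"
    using null[of "p + s *\<^sub>R q"] null[of "p + t *\<^sub>R q"] roots
    by (simp_all add: bilinear_expand_add_scale[OF f] bilinear_expand_add_scale[OF g] b_def)
  \<comment> \<open>These weights cancel the linear coefficient \<open>b\<close>.\<close>
  then have "0 \<le> t * (f p p + s * b + s\<^sup>2 * f q q) + (- s) * (f p p + t * b + t\<^sup>2 * f q q)"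
    using st by (intro add_nonneg_nonneg[OF mult_nonneg_nonneg mult_nonneg_nonneg]) auto
  also have "\<dots> = (t - s) * (f p p - s * t * f q q)"
    by (simp add: algebra_simps power2_eq_square)
  finally have "f p p - g p p / g q q * f q q \<ge> 0"
    using st by (simp add: zero_le_mult_iff)
  then show ?thesis
    using p q by (simp add: field_simps)
qed

text \<open>At a null vector the quadratic form has no constant term along a line, so for small
  \<open>t\<close> its sign is that of the linear term, which a suitable direction makes
  positive.\<close>

lemma null_vector_positive_perturbation:
  fixes g :: "'a::real_vector \<Rightarrow> 'a \<Rightarrow> real"
  assumes g: "bilinear g" and sym: "\<And>u w. g u w = g w u"
    and "g v v = 0" and w: "g v w \<noteq> 0"
  obtains w' where "\<forall>\<^sub>F t in at_right 0. g (v + t *\<^sub>R w') (v + t *\<^sub>R w') > 0"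
proof -
  \<comment> \<open>Scaling by \<open>g v w\<close> makes \<open>g v w'\<close> the square of
    \<open>g v w\<close>, hence positive whatever the sign of \<open>g v w\<close>.\<close>
  define w' where "w' = g v w *\<^sub>R w"
  define b where "b = g v w'"
  have b: "b > 0"
    using w by (simp add: w'_def b_def bilinear_rmul[OF g] power2_eq_square[symmetric])
  have lim: "((\<lambda>t. 2 * b + t * g w' w') \<longlongrightarrow> 2 * b + 0 * g w' w') (at_right 0)"
    by (intro tendsto_intros)
  have "\<forall>\<^sub>F t in at_right 0. 2 * b + t * g w' w' > 0"
    by (rule order_tendstoD(1)[OF lim]) (simp add: b)
  moreover have "\<forall>\<^sub>F t::real in at_right 0. t > 0"
    by (simp add: eventually_at_right_less)
  ultimately have "\<forall>\<^sub>F t in at_right 0. g (v + t *\<^sub>R w') (v + t *\<^sub>R w') > 0"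
  proof eventually_elim
    case (elim t)
    have "g (v + t *\<^sub>R w') (v + t *\<^sub>R w') = t * (2 * b + t * g w' w')"
      using assms(3) sym[of w' v]
      by (simp add: bilinear_expand_add_scale[OF g] b_def algebra_simps power2_eq_square)
    then show ?case using elim by simp
  qed
  then show thesis by (rule that)
qed

lemma nonneg_on_null_vectors:
  fixes f g :: "'a::real_vector \<Rightarrow> 'a \<Rightarrow> real"
  assumes f: "bilinear f" and g: "bilinear g" and sym: "\<And>u w. g u w = g w u"
    and nondeg: "\<And>u. u \<noteq> 0 \<Longrightarrow> \<exists>w. g u w \<noteq> 0"
    and bound: "\<And>p. g p p > 0 \<Longrightarrow> B * g p p \<le> f p p"
    and v: "g v v = 0"
  shows "f v v \<ge> 0"
proof (cases "v = 0")
  case True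
  then show ?thesis by (simp add: bilinear_lzero[OF f])
next
  case False
  then obtain w where "g v w \<noteq> 0" using nondeg by blast
  then obtain w' where pos: "\<forall>\<^sub>F t in at_right 0. g (v + t *\<^sub>R w') (v + t *\<^sub>R w') > 0"
    using null_vector_positive_perturbation[OF g sym v] by blast
  have lim: "((\<lambda>t. h (v + t *\<^sub>R w') (v + t *\<^sub>R w')) \<longlongrightarrow> h v v) (at_right 0)"
    if "bilinear h" for h :: "'a \<Rightarrow> 'a \<Rightarrow> real"
    unfolding bilinear_expand_add_scale[OF that] by (auto intro!: tendsto_eq_intros)
  \<comment> \<open>The bound holds only where \<open>g\<close> is positive, so it is applied along
    \<open>v + t w'\<close>. Both sides are polynomials in \<open>t\<close> and converge as
    \<open>t\<close> decreases to 0; the left limit is 0 for any \<open>B\<close>.\<close>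
  have "B * g v v \<le> f v v"
  proof (rule tendsto_le)
    show "at_right (0::real) \<noteq> bot" by simp
    show "\<forall>\<^sub>F t in at_right 0. B * g (v + t *\<^sub>R w') (v + t *\<^sub>R w') \<le> f (v + t *\<^sub>R w') (v + t *\<^sub>R w')"
      using pos by eventually_elim (rule bound)
  qed (intro tendsto_intros lim f g)+
  then show ?thesis using v by simp
qed

text \<open>A nonzero null vector could be perturbed, by the construction above applied to
  \<open>- g\<close>, to a vector on which \<open>g\<close> is negative.\<close>

lemma nondegenerate_nonneg_imp_pos:
  fixes g :: "'a::real_vector \<Rightarrow> 'a \<Rightarrow> real"
  assumes g: "bilinear g" and sym: "\<And>u w. g u w = g w u"
    and nondeg: "\<And>u. u \<noteq> 0 \<Longrightarrow> \<exists>w. g u w \<noteq> 0"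
    and nonneg: "\<And>u. g u u \<ge> 0" and "v \<noteq> 0"
  shows "g v v > 0"
proof (rule ccontr)
  assume "\<not> g v v > 0"
  then have "g v v = 0" using nonneg[of v] by simp
  obtain w where "g v w \<noteq> 0" using nondeg \<open>v \<noteq> 0\<close> by blast
  have "bilinear (\<lambda>u w. - g u w)"
    using g unfolding bilinear_def by (auto intro: linear_compose_neg)
  then obtain w' where "\<forall>\<^sub>F t in at_right 0. - g (v + t *\<^sub>R w') (v + t *\<^sub>R w') > 0"
    by (rule null_vector_positive_perturbation[where v = v and w = w])
      (use sym \<open>g v v = 0\<close> \<open>g v w \<noteq> 0\<close> in auto)
  then obtain t :: real where "- g (v + t *\<^sub>R w') (v + t *\<^sub>R w') > 0"
    using eventually_happens'[OF trivial_limit_at_right_real] by blast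
  then show False using nonneg[of "v + t *\<^sub>R w'"] by simp
qed

section \<open>Continuous families of bilinear forms\<close>

lemma bilinear_expand_Basis:
  fixes f :: "'e::euclidean_space \<Rightarrow> 'e \<Rightarrow> real"
  assumes "bilinear f"
  shows "f u v = (\<Sum>i\<in>Basis. \<Sum>j\<in>Basis. (u \<bullet> i) * (v \<bullet> j) * f i j)"
proof -
  have "f u v = f (\<Sum>i\<in>Basis. (u \<bullet> i) *\<^sub>R i) (\<Sum>j\<in>Basis. (v \<bullet> j) *\<^sub>R j)"
    by (simp add: euclidean_representation)
  also have "\<dots> = (\<Sum>(i, j)\<in>Basis \<times> Basis. f ((u \<bullet> i) *\<^sub>R i) ((v \<bullet> j) *\<^sub>R j))"
    by (rule bilinear_sum[OF assms])
  finally show ?thesis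
    by (simp add: sum.cartesian_product bilinear_lmul[OF assms] bilinear_rmul[OF assms]
        case_prod_unfold ac_simps)
qed

text \<open>Continuity jointly in the point and the vector is what the tube argument below requires;
  it follows from the finite expansion in components.\<close>

lemma continuous_on_bilinear_family:
  fixes K :: "'e::euclidean_space \<Rightarrow> 'e \<Rightarrow> 'x::topological_space \<Rightarrow> real"
  assumes bil: "\<And>x. x \<in> S \<Longrightarrow> bilinear (\<lambda>u v. K u v x)"
    and cont: "\<And>i j. i \<in> Basis \<Longrightarrow> j \<in> Basis \<Longrightarrow> continuous_on S (K i j)"
  shows "continuous_on (S \<times> UNIV) (\<lambda>(x, u). K u u x)"
proof -
  have "continuous_on (S \<times> UNIV)
      (\<lambda>z. \<Sum>i\<in>Basis. \<Sum>j\<in>Basis. (snd z \<bullet> i) * (snd z \<bullet> j) * K i j (fst z))"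
    by (intro continuous_intros continuous_on_compose2[OF cont]) auto
  then show ?thesis
    by (rule continuous_on_eq) (auto simp: bilinear_expand_Basis[OF bil])
qed

lemma continuous_on_quadratic_param:
  fixes K :: "'e::euclidean_space \<Rightarrow> 'e \<Rightarrow> 'x::topological_space \<Rightarrow> real"
  assumes "continuous_on (S \<times> UNIV) (\<lambda>(x, u). K u u x)"
  shows "continuous_on S (K u u)"
proof -
  have "continuous_on S (\<lambda>x. (\<lambda>(x, u). K u u x) (x, u))"
    by (rule continuous_on_compose2[OF assms]) (auto intro!: continuous_intros)
  then show ?thesis by simp
qed

text \<open>This is the local estimate in one chart: \<open>x\<close> is a coordinate point and
  \<open>u\<close> a vector of components. The cases are whether \<open>G\<close> takes a negative
  value at \<open>x0\<close> or is positive definite there.\<close>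

lemma local_ratio_bound:
  fixes F G :: "'e::euclidean_space \<Rightarrow> 'e \<Rightarrow> 'x::topological_space \<Rightarrow> real"
  assumes S: "open S" "x0 \<in> S"
    and bilF: "\<And>x. x \<in> S \<Longrightarrow> bilinear (\<lambda>u v. F u v x)"
    and bilG: "\<And>x. x \<in> S \<Longrightarrow> bilinear (\<lambda>u v. G u v x)"
    and contF: "\<And>i j. i \<in> Basis \<Longrightarrow> j \<in> Basis \<Longrightarrow> continuous_on S (F i j)"
    and contG: "\<And>i j. i \<in> Basis \<Longrightarrow> j \<in> Basis \<Longrightarrow> continuous_on S (G i j)"
    and sym: "\<And>u v. G u v x0 = G v u x0"
    and nondeg: "\<And>u. u \<noteq> 0 \<Longrightarrow> \<exists>v. G u v x0 \<noteq> 0"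
    and null: "\<And>x u. x \<in> S \<Longrightarrow> G u u x = 0 \<Longrightarrow> F u u x \<ge> 0"
  obtains V B where "open V" "x0 \<in> V" "V \<subseteq> S"
    "\<And>x u. x \<in> V \<Longrightarrow> G u u x > 0 \<Longrightarrow> B * G u u x \<le> F u u x"
proof -
  have cF: "continuous_on (S \<times> UNIV) (\<lambda>(x, u). F u u x)"
    using bilF contF by (rule continuous_on_bilinear_family)
  have cG: "continuous_on (S \<times> UNIV) (\<lambda>(x, u). G u u x)"
    using bilG contG by (rule continuous_on_bilinear_family)
  show thesis
  proof (cases "\<exists>q. G q q x0 < 0")
    case True
    then obtain q where q: "G q q x0 < 0" by blast
    \<comment> \<open>Subtracting 1 makes \<open>F q q x - B * G q q x\<close> equal to
      \<open>G q q x0 < 0\<close> at \<open>x0\<close>. The strict inequality persists nearby, and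
      division by the negative \<open>G q q x\<close> gives \<open>B\<close> below the ratio at
      \<open>q\<close>, hence below the ratio at every \<open>u\<close> with
      \<open>G u u x > 0\<close>.\<close>
    define B where "B = F q q x0 / G q q x0 - 1"
    define V where "V = S \<inter> {x \<in> S. G q q x \<in> {..<0} \<and> F q q x - B * G q q x \<in> {..<0}}"
    have cFq: "continuous_on S (F q q)" and cGq: "continuous_on S (G q q)"
      using cF cG by (auto intro: continuous_on_quadratic_param)
    have "open (S \<inter> G q q -` {..<0})" "open (S \<inter> (\<lambda>x. F q q x - B * G q q x) -` {..<0})"
      using S(1) cFq cGq
      by (auto intro!: continuous_open_preimage continuous_intros)
    moreover have "V = (S \<inter> G q q -` {..<0}) \<inter> (S \<inter> (\<lambda>x. F q q x - B * G q q x) -` {..<0})"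
      by (auto simp: V_def)
    ultimately have "open V" by auto
    moreover have "x0 \<in> V"
      using S(2) q by (simp add: V_def B_def algebra_simps)
    moreover have "B * G u u x \<le> F u u x" if x: "x \<in> V" and u: "G u u x > 0" for x u
    proof -
      have "x \<in> S" "G q q x < 0" "F q q x < B * G q q x"
        using x by (auto simp: V_def)
      then have "B \<le> F q q x / G q q x" by (simp add: neg_le_divide_eq)
      also have "\<dots> \<le> F u u x / G u u x"
        by (rule bilinear_ratio_le) (use bilF bilG null \<open>x \<in> S\<close> u \<open>G q q x < 0\<close> in auto)
      finally show ?thesis using u by (simp add: pos_le_divide_eq)
    qed
    ultimately show thesis by (intro that[of V B]) (auto simp: V_def)
  next
    case False
    then have nonneg: "G u u x0 \<ge> 0" for u by (simp add: not_less)
    have pos: "G u u x0 > 0" if "u \<noteq> 0" for u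
      by (rule nondegenerate_nonneg_imp_pos[of "\<lambda>u v. G u v x0"])
        (use bilG S sym nondeg nonneg that in auto)
    have slice: "continuous_on (sphere 0 1) (\<lambda>u. K u u x0)"
      if "continuous_on (S \<times> UNIV) (\<lambda>(x, u). K u u x)" for K :: "'e \<Rightarrow> 'e \<Rightarrow> 'x \<Rightarrow> real"
    proof -
      have "continuous_on (sphere 0 1) (\<lambda>u. (\<lambda>(x, u). K u u x) (x0, u))"
        by (rule continuous_on_compose2[OF that]) (use S in \<open>auto intro!: continuous_intros\<close>)
      then show ?thesis by simp
    qed
    have "continuous_on (sphere 0 1) (\<lambda>u. F u u x0 / G u u x0)"
      using slice[of F, OF cF] slice[of G, OF cG]
    proof (rule continuous_on_divide)
      show "\<forall>u\<in>sphere 0 1. G u u x0 \<noteq> 0"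
      proof
        fix u :: 'e assume "u \<in> sphere 0 1"
        then have "u \<noteq> 0" by auto
        then show "G u u x0 \<noteq> 0" using pos[of u] by simp
      qed
    qed
    then have "compact ((\<lambda>u. F u u x0 / G u u x0) ` sphere 0 1)"
      by (rule compact_continuous_image) simp
    then have "bounded ((\<lambda>u. F u u x0 / G u u x0) ` sphere 0 1)"
      by (rule compact_imp_bounded)
    then obtain C where C: "\<And>u. u \<in> sphere 0 1 \<Longrightarrow> \<bar>F u u x0 / G u u x0\<bar> \<le> C"
      unfolding bounded_real by blast
    \<comment> \<open>This lies strictly below every ratio on the unit sphere over
      \<open>x0\<close>, so \<open>H\<close> is strictly positive there and the condition defining
      \<open>W\<close> is open.\<close>
    define B where "B = - C - 1"
    define H where "H = (\<lambda>(x, u). F u u x - B * G u u x)"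
    have cH: "continuous_on (S \<times> UNIV) H"
      unfolding H_def case_prod_unfold
      using cF cG by (intro continuous_intros) (auto simp: case_prod_unfold)
    define W where "W = S \<times> UNIV \<inter> H -` {0<..}"
    have "open W"
      unfolding W_def
      by (rule continuous_open_preimage[OF cH]) (use S in \<open>auto intro: open_Times\<close>)
    have "{x0} \<times> sphere 0 1 \<subseteq> W"
    proof
      fix w :: "'x \<times> 'e" assume "w \<in> {x0} \<times> sphere 0 1"
      then obtain u where w: "w = (x0, u)" and u: "norm u = 1" by auto
      then have "\<bar>F u u x0 / G u u x0\<bar> \<le> C" by (intro C) simp
      then have "B < F u u x0 / G u u x0" unfolding B_def by linarith
      moreover have "G u u x0 > 0" using u by (intro pos) auto
      ultimately show "w \<in> W"
        using S by (simp add: w W_def H_def pos_less_divide_eq)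
    qed
    \<comment> \<open>Compactness of the sphere gives one neighbourhood of \<open>x0\<close> that
      serves all unit vectors at once.\<close>
    from Elementary_Topology.tube_lemma[OF compact_sphere \<open>open W\<close> this]
    obtain V where V: "x0 \<in> V" "open V" "V \<times> sphere 0 1 \<subseteq> W"
      by (elim exE conjE)
    \<comment> \<open>The sphere is nonempty, so each \<open>x\<close> in \<open>V\<close> occurs in
      a pair belonging to \<open>W\<close>, hence lies in \<open>S\<close>.\<close>
    have "(SOME i. i \<in> Basis) \<in> sphere (0::'e) 1"
      by (simp add: SOME_Basis norm_Basis)
    then have "V \<subseteq> S" using V(3) unfolding W_def by blast
    moreover have "B * G u u x \<le> F u u x" if x: "x \<in> V" for x u
    proof (cases "u = 0")
      case True
      then show ?thesis
        using \<open>V \<subseteq> S\<close> x bilinear_lzero[OF bilF] bilinear_lzero[OF bilG] by auto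
    next
      case False
      \<comment> \<open>Both sides are homogeneous of degree two, so the inequality for unit vectors
        extends to all \<open>u\<close>.\<close>
      define e where "e = u /\<^sub>R norm u"
      have u: "u = norm u *\<^sub>R e" and "norm e = 1" using False by (simp_all add: e_def)
      then have "(x, e) \<in> V \<times> sphere 0 1" using x by simp
      then have "(x, e) \<in> W" using V(3) by (rule rev_subsetD)
      then have "H (x, e) > 0" by (simp add: W_def)
      then have "(norm u)\<^sup>2 * (B * G e e x) \<le> (norm u)\<^sup>2 * F e e x"
        by (intro mult_left_mono) (auto simp: H_def)
      moreover have "G u u x = (norm u)\<^sup>2 * G e e x" "F u u x = (norm u)\<^sup>2 * F e e x"
        using bilinear_scale_both[OF bilF, of x "norm u" e] bilinear_scale_both[OF bilG, of x "norm u" e]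
          u x \<open>V \<subseteq> S\<close> by auto
      ultimately show ?thesis by (simp add: algebra_simps)
    qed
    ultimately show thesis using V by (intro that[of V B]) auto
  qed
qed

section \<open>Tangent vectors in charts\<close>

lemma smooth_on_differentiable:
  assumes "smooth_on S f" "x \<in> S"
  shows "f differentiable (at x)"
proof -
  have "Ck_on (Suc 0) S f" using assms(1) unfolding smooth_on_def by blast
  then show ?thesis using assms(2) by simp
qed

lemma Ck_on_Suc_continuous_on:
  assumes "Ck_on (Suc k) S f"
  shows "continuous_on S f"
  using assms by (auto intro!: continuous_at_imp_continuous_on differentiable_imp_continuous_within)

lemma chart_inv_chart_map:
  assumes "is_chart X c" "z \<in> chart_dom c"
  shows "chart_inv c (chart_map c z) = z"
proof -
  have "chart_dom c \<subseteq> topspace X" using assms(1) by (simp add: is_chart_def openin_subset)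
  then have "inj_on (chart_map c) (chart_dom c)"
    using assms(1) by (auto simp: is_chart_def homeomorphic_eq_everything_map Int_absorb1)
  then show ?thesis using assms(2) by (simp add: chart_inv_def)
qed

lemma chart_map_image_open:
  assumes c: "is_chart X c" and U: "openin X U" "U \<subseteq> chart_dom c"
  shows "open (chart_map c ` U)"
proof -
  have "open_map (subtopology X (chart_dom c)) (top_of_set (chart_map c ` chart_dom c)) (chart_map c)"
    using c by (simp add: is_chart_def homeomorphic_imp_open_map)
  moreover have "openin (subtopology X (chart_dom c)) U"
    using U by (auto simp: openin_subtopology)
  ultimately have "openin (top_of_set (chart_map c ` chart_dom c)) (chart_map c ` U)"
    by (simp add: open_map_def)
  then show ?thesis
    using c openin_open_trans by (auto simp: is_chart_def)
qed

lemma chart_map_preimage_open: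
  assumes c: "is_chart X c" and V: "open V"
  shows "openin X {z \<in> chart_dom c. chart_map c z \<in> V}"
proof -
  have "continuous_map (subtopology X (chart_dom c)) euclidean (chart_map c)"
    using c by (metis is_chart_def homeomorphic_imp_continuous_map continuous_map_into_fulltopology)
  then have "openin (subtopology X (chart_dom c))
      {z \<in> topspace (subtopology X (chart_dom c)). chart_map c z \<in> V}"
    using V by (intro openin_continuous_map_preimage) auto
  moreover have "topspace (subtopology X (chart_dom c)) = chart_dom c"
    using c by (auto simp: is_chart_def dest: openin_subset)
  ultimately have "openin (subtopology X (chart_dom c)) {z \<in> chart_dom c. chart_map c z \<in> V}"
    by (simp only:)
  then show ?thesis
    using c openin_trans_full unfolding is_chart_def by blast
qed

context
  fixes X :: "'m topology" and A :: "('m, 'e::euclidean_space) chart set"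
  assumes M: "smooth_manifold X A"
begin

lemma charts_atD:
  assumes "c \<in> charts_at A z"
  shows "c \<in> A" "z \<in> chart_dom c" "is_chart X c" "z \<in> topspace X"
    "chart_inv c (chart_map c z) = z"
  using assms M chart_inv_chart_map[of X c z]
  by (auto simp: charts_at_def smooth_manifold_def)

lemma transition_has_derivative:
  assumes "c \<in> charts_at A z" "d \<in> charts_at A z"
  shows "(transition c d has_derivative frechet_derivative (transition c d) (at (chart_map c z)))
    (at (chart_map c z))"
proof -
  have "smooth_on (chart_map c ` (chart_dom c \<inter> chart_dom d)) (transition c d)"
    using M assms by (auto simp: smooth_manifold_def charts_at_def)
  then have "transition c d differentiable (at (chart_map c z))"
    using assms by (intro smooth_on_differentiable) (auto simp: charts_at_def)
  then show ?thesis by (simp add: frechet_derivative_works)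
qed

lemma transition_chart_map:
  assumes "c \<in> charts_at A z"
  shows "transition c d (chart_map c z) = chart_map d z"
  using charts_atD[OF assms] by (simp add: transition_def)

text \<open>The cocycle law for changes of coordinates, by the chain rule. As
  \<open>chart_inv\<close> is arbitrary off the image of a chart, the transition maps compose only
  on the image of the triple overlap; this set is open, which suffices for derivatives.\<close>

lemma frechet_derivative_transition_comp:
  assumes c: "c \<in> charts_at A z" and d: "d \<in> charts_at A z" and e: "e \<in> charts_at A z"
  shows "frechet_derivative (transition c e) (at (chart_map c z)) v =
    frechet_derivative (transition d e) (at (chart_map d z))
      (frechet_derivative (transition c d) (at (chart_map c z)) v)"
proof -
  let ?U = "chart_dom c \<inter> chart_dom d \<inter> chart_dom e"
  have "openin X ?U"
    using charts_atD(3)[OF c] charts_atD(3)[OF d] charts_atD(3)[OF e] by (auto simp: is_chart_def)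
  then have op: "open (chart_map c ` ?U)"
    using charts_atD(3)[OF c] by (intro chart_map_image_open) auto
  have z: "chart_map c z \<in> chart_map c ` ?U"
    using charts_atD(2)[OF c] charts_atD(2)[OF d] charts_atD(2)[OF e] by auto
  have "(transition d e has_derivative frechet_derivative (transition d e) (at (chart_map d z)))
    (at (transition c d (chart_map c z)))"
    using transition_has_derivative[OF d e] by (simp add: transition_chart_map[OF c])
  from diff_chain_at[OF transition_has_derivative[OF c d] this]
  have "(transition d e \<circ> transition c d has_derivative
      frechet_derivative (transition d e) (at (chart_map d z)) \<circ>
      frechet_derivative (transition c d) (at (chart_map c z))) (at (chart_map c z))" .
  moreover have "(transition d e \<circ> transition c d) x = transition c e x"
    if "x \<in> chart_map c ` ?U" for x
    using that chart_inv_chart_map[OF charts_atD(3)[OF c]] chart_inv_chart_map[OF charts_atD(3)[OF d]]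
    by (auto simp: transition_def)
  ultimately have "(transition c e has_derivative
      frechet_derivative (transition d e) (at (chart_map d z)) \<circ>
      frechet_derivative (transition c d) (at (chart_map c z))) (at (chart_map c z))"
    using op z by (blast intro: has_derivative_transform_within_open)
  from fun_cong[OF frechet_derivative_at[OF this], of v] show ?thesis by simp
qed

lemma frechet_derivative_transition_self:
  assumes c: "c \<in> charts_at A z"
  shows "frechet_derivative (transition c c) (at (chart_map c z)) v = v"
proof -
  have "((\<lambda>x. x) has_derivative (\<lambda>x. x)) (at (chart_map c z))" by simp
  moreover have "open (chart_map c ` chart_dom c)" "chart_map c z \<in> chart_map c ` chart_dom c"
    using charts_atD[OF c] by (auto simp: is_chart_def)
  moreover have "x = transition c c x" if "x \<in> chart_map c ` chart_dom c" for x
    using that chart_inv_chart_map[OF charts_atD(3)[OF c]] by (auto simp: transition_def)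
  ultimately have "(transition c c has_derivative (\<lambda>x. x)) (at (chart_map c z))"
    by (rule has_derivative_transform_within_open)
  from fun_cong[OF frechet_derivative_at[OF this], of v] show ?thesis by simp
qed

text \<open>This and the next three lemmas make \<open>coord_vec A c z\<close> a linear isomorphism
  from the model space onto the tangent space, with evaluation at \<open>c\<close> as its inverse.
  The compatibility between charts is the cocycle law.\<close>

lemma coord_vec_in_tangent_space:
  assumes "c \<in> charts_at A z"
  shows "coord_vec A c z e \<in> tangent_space A z"
  unfolding tangent_space_def coord_vec_def
  by (auto intro: frechet_derivative_transition_comp[OF assms])

lemma coord_vec_self:
  assumes "c \<in> charts_at A z"
  shows "coord_vec A c z e c = e"
  using assms by (simp add: coord_vec_def frechet_derivative_transition_self)

lemma coord_vec_of_tangent: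
  assumes "c \<in> charts_at A z" "v \<in> tangent_space A z"
  shows "coord_vec A c z (v c) = v"
proof
  fix d
  have "v d = frechet_derivative (transition c d) (at (chart_map c z)) (v c)" if "d \<in> charts_at A z"
    using assms that unfolding tangent_space_def by blast
  moreover have "v d = 0" if "d \<notin> charts_at A z"
    using assms(2) that unfolding tangent_space_def by blast
  ultimately show "coord_vec A c z (v c) d = v d"
    by (simp only: coord_vec_def split: if_split) simp
qed

lemma coord_vec_linear:
  assumes c: "c \<in> charts_at A z"
  shows "coord_vec A c z (a *\<^sub>R u + b *\<^sub>R v) = (\<lambda>d. a *\<^sub>R coord_vec A c z u d + b *\<^sub>R coord_vec A c z v d)"
proof
  fix d
  show "coord_vec A c z (a *\<^sub>R u + b *\<^sub>R v) d = a *\<^sub>R coord_vec A c z u d + b *\<^sub>R coord_vec A c z v d"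
  proof (cases "d \<in> charts_at A z")
    case True
    have "linear (frechet_derivative (transition c d) (at (chart_map c z)))"
      using transition_has_derivative[OF c True] by (rule has_derivative_linear)
    then show ?thesis using True by (simp add: coord_vec_def linear_add linear_scale)
  qed (simp add: coord_vec_def)
qed

section \<open>Tensor fields as bilinear forms on the model space\<close>

lemma tensor02_component_chart_map:
  assumes "c \<in> charts_at A z"
  shows "tensor02_component A T c u v (chart_map c z) = T z (coord_vec A c z u) (coord_vec A c z v)"
  using charts_atD(5)[OF assms] by (simp add: tensor02_component_def)

lemma bilinear_tensor02_component:
  assumes T: "tensor02_field X A T" and c: "c \<in> charts_at A z"
  shows "bilinear (\<lambda>u v. tensor02_component A T c u v (chart_map c z))"
proof -
  define cv where "cv = coord_vec A c z"
  have cv: "cv u \<in> tangent_space A z" for u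
    using coord_vec_in_tangent_space[OF c] by (simp add: cv_def)
  have comb: "cv (a *\<^sub>R u + b *\<^sub>R v) = (\<lambda>d. a *\<^sub>R cv u d + b *\<^sub>R cv v d)" for a b u v
    using coord_vec_linear[OF c] by (simp add: cv_def)
  have lin: "T z (cv (a *\<^sub>R u + b *\<^sub>R v)) (cv w) = a * T z (cv u) (cv w) + b * T z (cv v) (cv w)"
    "T z (cv w) (cv (a *\<^sub>R u + b *\<^sub>R v)) = a * T z (cv w) (cv u) + b * T z (cv w) (cv v)" for a b u v w
    using T cv charts_atD(4)[OF c] unfolding tensor02_field_def comb by blast+
  have linearI': "linear h" if "\<And>a b u v. h (a *\<^sub>R u + b *\<^sub>R v) = a * h u + b * h v" for h :: "'e \<Rightarrow> real"
  proof (rule linearI)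
    show "h (u + v) = h u + h v" for u v using that[of 1 u 1 v] by simp
    show "h (r *\<^sub>R u) = r *\<^sub>R h u" for r u using that[of r u 0 u] by simp
  qed
  then have "bilinear (\<lambda>u v. T z (cv u) (cv v))"
    unfolding bilinear_def by (intro allI conjI) (rule linearI', rule lin)+
  then show ?thesis by (simp add: tensor02_component_chart_map[OF c] cv_def)
qed

text \<open>Every tangent vector has the form \<open>coord_vec A c z v\<close>, so a vector
  orthogonal to all of these is orthogonal to the whole tangent space.\<close>

lemma metric_component_nondegenerate:
  assumes g: "pseudo_riemannian_metric X A g" and c: "c \<in> charts_at A z" and "u \<noteq> 0"
  shows "\<exists>v. tensor02_component A g c u v (chart_map c z) \<noteq> 0"
proof (rule ccontr)
  assume "\<not> ?thesis"
  then have "g z (coord_vec A c z u) v = 0" if "v \<in> tangent_space A z" for v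
    using coord_vec_of_tangent[OF c that] by (metis tensor02_component_chart_map[OF c])
  then have "coord_vec A c z u = (\<lambda>c. 0)"
    using g coord_vec_in_tangent_space[OF c] charts_atD(4)[OF c]
    unfolding pseudo_riemannian_metric_def by blast
  then show False using coord_vec_self[OF c, of u] \<open>u \<noteq> 0\<close> by simp
qed

lemma metric_component_sym:
  assumes g: "pseudo_riemannian_metric X A g" and c: "c \<in> charts_at A z"
  shows "tensor02_component A g c u v (chart_map c z) = tensor02_component A g c v u (chart_map c z)"
proof -
  have "\<forall>u\<in>tangent_space A z. \<forall>v\<in>tangent_space A z. g z u v = g z v u"
    using g charts_atD(4)[OF c] unfolding pseudo_riemannian_metric_def by blast
  then show ?thesis
    using coord_vec_in_tangent_space[OF c] by (simp add: tensor02_component_chart_map[OF c])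
qed

lemma nonneg_on_null_vectors_at:
  assumes g: "pseudo_riemannian_metric X A g" and F: "tensor02_field X A F"
    and z: "z \<in> topspace X" and v: "v \<in> null_vectors A g z"
    and bound: "\<And>p. p \<in> tangent_space A z \<Longrightarrow> g z p p > 0 \<Longrightarrow> B * g z p p \<le> F z p p"
  shows "F z v v \<ge> 0"
proof -
  obtain c where c: "c \<in> charts_at A z"
    using M z unfolding smooth_manifold_def charts_at_def by blast
  have vt: "v \<in> tangent_space A z" and gv: "g z v v = 0" using v by (auto simp: null_vectors_def)
  note comp = tensor02_component_chart_map[OF c]
  have "tensor02_component A F c (v c) (v c) (chart_map c z) \<ge> 0"
  proof (rule nonneg_on_null_vectors[where B = B
        and f = "\<lambda>u v. tensor02_component A F c u v (chart_map c z)"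
        and g = "\<lambda>u v. tensor02_component A g c u v (chart_map c z)"])
    show "bilinear (\<lambda>u v. tensor02_component A F c u v (chart_map c z))"
      using F c by (rule bilinear_tensor02_component)
    show "bilinear (\<lambda>u v. tensor02_component A g c u v (chart_map c z))"
      using g c by (auto intro: bilinear_tensor02_component
          simp: pseudo_riemannian_metric_def smooth_tensor02_field_def)
    show "tensor02_component A g c u w (chart_map c z) = tensor02_component A g c w u (chart_map c z)"
      for u w using g c by (rule metric_component_sym)
    show "\<exists>w. tensor02_component A g c u w (chart_map c z) \<noteq> 0" if "u \<noteq> 0" for u
      using g c that by (rule metric_component_nondegenerate)
    show "B * tensor02_component A g c p p (chart_map c z) \<le> tensor02_component A F c p p (chart_map c z)"
      if "0 < tensor02_component A g c p p (chart_map c z)" for p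
      using that bound coord_vec_in_tangent_space[OF c] by (simp add: comp)
    show "tensor02_component A g c (v c) (v c) (chart_map c z) = 0"
      using gv coord_vec_of_tangent[OF c vt] by (simp add: comp)
  qed
  then show ?thesis using coord_vec_of_tangent[OF c vt] by (simp add: comp)
qed

text \<open>The coordinate estimate is transported to the manifold: \<open>U\<close> is the preimage
  of \<open>V\<close> under the chart, and a tangent vector \<open>p\<close> is recovered from its
  components \<open>p c\<close>.\<close>

lemma local_tensor_bound:
  assumes g: "pseudo_riemannian_metric X A g" and F: "Ck_tensor02_field (Suc k) X A F"
    and z0: "z0 \<in> topspace X"
    and null: "\<And>z v. z \<in> topspace X \<Longrightarrow> v \<in> null_vectors A g z \<Longrightarrow> F z v v \<ge> 0"
  obtains U B where "openin X U" "z0 \<in> U"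
    "\<And>z p. z \<in> U \<Longrightarrow> p \<in> tangent_space A z \<Longrightarrow> g z p p > 0 \<Longrightarrow> B * g z p p \<le> F z p p"
proof -
  obtain c where c0: "c \<in> charts_at A z0"
    using M z0 unfolding smooth_manifold_def charts_at_def by blast
  let ?S = "chart_map c ` chart_dom c"
  let ?F = "tensor02_component A F c" and ?G = "tensor02_component A g c"
  note cA = charts_atD(1)[OF c0] and chart = charts_atD(3)[OF c0]
  have chart_at: "c \<in> charts_at A z" if "z \<in> chart_dom c" for z
    using that cA by (simp add: charts_at_def)
  have tF: "tensor02_field X A F" and tG: "tensor02_field X A g"
    using F g by (auto simp: Ck_tensor02_field_def pseudo_riemannian_metric_def smooth_tensor02_field_def)
  obtain V B where V: "open V" "chart_map c z0 \<in> V" "V \<subseteq> ?S"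
    and B: "\<And>x u. x \<in> V \<Longrightarrow> ?G u u x > 0 \<Longrightarrow> B * ?G u u x \<le> ?F u u x"
  proof (rule local_ratio_bound[of ?S "chart_map c z0" ?F ?G])
    show "open ?S" using chart by (simp add: is_chart_def)
    show "chart_map c z0 \<in> ?S" using charts_atD(2)[OF c0] by simp
    show "bilinear (\<lambda>u v. ?F u v x)" "bilinear (\<lambda>u v. ?G u v x)" if "x \<in> ?S" for x
      using that bilinear_tensor02_component[OF tF chart_at] bilinear_tensor02_component[OF tG chart_at]
      by auto
    show "continuous_on ?S (?F i j)" if "i \<in> Basis" "j \<in> Basis" for i j
      using F cA that Ck_on_Suc_continuous_on unfolding Ck_tensor02_field_def by blast
    show "continuous_on ?S (?G i j)" if "i \<in> Basis" "j \<in> Basis" for i j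
    proof -
      have "Ck_on 0 ?S (?G i j)"
        using g cA that unfolding pseudo_riemannian_metric_def smooth_tensor02_field_def smooth_on_def
        by blast
      then show ?thesis by simp
    qed
    show "?G u v (chart_map c z0) = ?G v u (chart_map c z0)" for u v
      using g c0 by (rule metric_component_sym)
    show "\<exists>v. ?G u v (chart_map c z0) \<noteq> 0" if "u \<noteq> 0" for u
      using g c0 that by (rule metric_component_nondegenerate)
    show "?F u u x \<ge> 0" if x: "x \<in> ?S" and 0: "?G u u x = 0" for x u
    proof -
      obtain z where z: "z \<in> chart_dom c" "x = chart_map c z" using x by blast
      note c = chart_at[OF z(1)]
      \<comment> \<open>A null component vector represents a null tangent vector, so the hypothesis
        on \<open>F\<close> applies to it.\<close>
      have "coord_vec A c z u \<in> null_vectors A g z"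
        using 0 coord_vec_in_tangent_space[OF c]
        by (simp add: null_vectors_def z tensor02_component_chart_map[OF c])
      then show ?thesis
        using null charts_atD(4)[OF c] by (simp add: z tensor02_component_chart_map[OF c])
    qed
  qed (rule that)
  define U where "U = {z \<in> chart_dom c. chart_map c z \<in> V}"
  have "openin X U" unfolding U_def using chart V(1) by (rule chart_map_preimage_open)
  moreover have "z0 \<in> U" using V charts_atD(2)[OF c0] by (simp add: U_def)
  moreover have "B * g z p p \<le> F z p p" if "z \<in> U" "p \<in> tangent_space A z" "g z p p > 0" for z p
  proof -
    have c: "c \<in> charts_at A z" using that(1) chart_at by (simp add: U_def)
    show ?thesis
      using B[of "chart_map c z" "p c"] that coord_vec_of_tangent[OF c that(2)]
      by (simp add: U_def tensor02_component_chart_map[OF c])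
  qed
  ultimately show thesis by (rule that)
qed

end

section \<open>Compact sets and the infimum\<close>

text \<open>A finite subcover leaves finitely many local bounds, and by \<open>mono\<close> their
  minimum is valid on all of \<open>Z\<close>.\<close>

lemma compactin_local_lower_bound:
  fixes P :: "'m \<Rightarrow> real \<Rightarrow> bool"
  assumes Z: "compactin X Z"
    and local: "\<And>z. z \<in> Z \<Longrightarrow> \<exists>U B. openin X U \<and> z \<in> U \<and> (\<forall>y\<in>U. P y B)"
    and mono: "\<And>z B C. P z B \<Longrightarrow> C \<le> B \<Longrightarrow> P z C"
  obtains B where "\<And>z. z \<in> Z \<Longrightarrow> P z B"
proof -
  let ?\<U> = "{U. openin X U \<and> (\<exists>B. \<forall>y\<in>U. P y B)}"
  have "Z \<subseteq> \<Union>?\<U>" using local by blast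
  moreover have "\<forall>U\<in>?\<U>. openin X U" by blast
  ultimately obtain \<V> where \<V>: "finite \<V>" "\<V> \<subseteq> ?\<U>" "Z \<subseteq> \<Union>\<V>"
    using Z unfolding compactin_def by meson
  then have "\<forall>U\<in>\<V>. \<exists>B. \<forall>y\<in>U. P y B" by blast
  then obtain b where b: "\<And>U y. U \<in> \<V> \<Longrightarrow> y \<in> U \<Longrightarrow> P y (b U)" by metis
  \<comment> \<open>Inserting 0 keeps the set nonempty, so that \<open>Min\<close> is meaningful
    when the subcover is empty.\<close>
  define B where "B = Min (insert 0 (b ` \<V>))"
  have "P z B" if z: "z \<in> Z" for z
  proof -
    obtain U where U: "U \<in> \<V>" "z \<in> U" using \<V>(3) z by blast
    have "B \<le> b U" unfolding B_def using U \<V>(1) by (intro Min_le) auto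
    then show ?thesis using b[OF U] mono by blast
  qed
  then show thesis by (rule that)
qed

text \<open>An extended real above minus infinity has a real number below it, and
  \<open>g z p p > 0\<close> permits cross-multiplication. If no vector is positive, the infimum is
  \<open>\<infinity>\<close> and both sides hold.\<close>

lemma C_T_gt_MInfty_iff:
  "C_T A g F Z > -\<infinity> \<longleftrightarrow>
    (\<exists>B. \<forall>z\<in>Z. \<forall>p\<in>tangent_space A z. g z p p > 0 \<longrightarrow> B * g z p p \<le> F z p p)" (is "?L \<longleftrightarrow> ?R")
proof
  assume ?L
  then obtain B where B: "ereal B < C_T A g F Z" using ereal_dense2 by blast
  have "B * g z p p \<le> F z p p" if "z \<in> Z" "p \<in> tangent_space A z" "g z p p > 0" for z p
  proof -
    have "C_T A g F Z \<le> ereal (F z p p / g z p p)"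
      unfolding C_T_def using that by (intro INF_lower2[of z] INF_lower) auto
    with B have "B \<le> F z p p / g z p p" by (meson ereal_less_eq(3) less_imp_le order_trans)
    then show ?thesis using that(3) by (simp add: pos_le_divide_eq)
  qed
  then show ?R by blast
next
  assume ?R
  then obtain B where B: "\<And>z p. z \<in> Z \<Longrightarrow> p \<in> tangent_space A z \<Longrightarrow> g z p p > 0 \<Longrightarrow> B * g z p p \<le> F z p p"
    by blast
  have "ereal B \<le> C_T A g F Z"
    unfolding C_T_def using B by (intro INF_greatest) (auto simp: pos_le_divide_eq)
  then show ?L by (meson MInfty_neq_ereal(1) ereal_infty_less(2) less_le_trans)
qed

theorem corollary27:
  fixes X :: "'m topology"
    and A :: "('m, 'e::euclidean_space) chart set"
    and g F :: "('m, 'e) tensor02"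
  assumes "smooth_manifold X A"
    and "pseudo_riemannian_metric X A g"
    and "Ck_tensor02_field 1 X A F"
  shows "(\<forall>z\<in>topspace X. \<forall>v\<in>null_vectors A g z. F z v v \<ge> 0) \<longleftrightarrow>
         (\<forall>Z. compactin X Z \<longrightarrow> C_T A g F Z > -\<infinity>)"
proof (intro iffI allI impI ballI)
  fix Z
  assume null: "\<forall>z\<in>topspace X. \<forall>v\<in>null_vectors A g z. F z v v \<ge> 0" and Z: "compactin X Z"
  let ?P = "\<lambda>z B. \<forall>p\<in>tangent_space A z. g z p p > 0 \<longrightarrow> B * g z p p \<le> F z p p"
  obtain B where "\<And>z. z \<in> Z \<Longrightarrow> ?P z B"
  proof (rule compactin_local_lower_bound[OF Z, of ?P])
    fix z assume "z \<in> Z"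
    then have "z \<in> topspace X" using Z compactin_subset_topspace by blast
    then obtain U B where "openin X U" "z \<in> U"
      "\<And>z p. z \<in> U \<Longrightarrow> p \<in> tangent_space A z \<Longrightarrow> g z p p > 0 \<Longrightarrow> B * g z p p \<le> F z p p"
      using local_tensor_bound[OF assms(1,2) assms(3)[unfolded One_nat_def]] null by blast
    then show "\<exists>U B. openin X U \<and> z \<in> U \<and> (\<forall>y\<in>U. ?P y B)" by blast
  next
    fix z and B C :: real assume "?P z B" "C \<le> B"
    then show "?P z C"
      by (meson less_imp_le mult_right_mono order_trans)
  qed (rule that)
  then show "C_T A g F Z > -\<infinity>" unfolding C_T_gt_MInfty_iff by blast
next
  fix z v
  assume "\<forall>Z. compactin X Z \<longrightarrow> C_T A g F Z > -\<infinity>"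
    and z: "z \<in> topspace X" and v: "v \<in> null_vectors A g z"
  \<comment> \<open>One-point sets are compact, and the limiting argument stays inside a single
    tangent space.\<close>
  then have "C_T A g F {z} > -\<infinity>" by simp
  then obtain B where "\<And>p. p \<in> tangent_space A z \<Longrightarrow> g z p p > 0 \<Longrightarrow> B * g z p p \<le> F z p p"
    unfolding C_T_gt_MInfty_iff by blast
  moreover have "tensor02_field X A F" using assms(3) by (simp add: Ck_tensor02_field_def)
  ultimately show "F z v v \<ge> 0"
    using nonneg_on_null_vectors_at[OF assms(1,2)] z v by blast
qed

end
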